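(* Let $n$ be a positive integer and let $T$ be an equilateral triangle of side length strictly greater than $n$. Then $T$ cannot be covered by $n^2+1$ equilateral triangles of side length $1$ each of which is homothetic to $T$.
   Context: Here a triangle is homothetic to $T$ if it is the image of $T$ under a homothety with positive or negative ratio; equivalently, an equilateral triangle homothetic to $T$ has its sides parallel to the sides of $T$ (it is either a translate of a scaled copy of $T$, or of the point reflection of $T$). "Cover" means the union of the small triangles contains $T$. *)

theory Defs
  imports "HOL-Analysis.Analysis"
begin

text \<open>Triangles are solid (closed regions) in the Euclidean plane.\<close>

definition equilateral_triangle :: "real \<Rightarrow> (real ^ 2) set \<Rightarrow> bool" where
  "equilateral_triangle s T \<longleftrightarrow>
     s > 0 \<and>
     (\<exists>a b c. dist a b = s \<and> dist b c = s \<and> dist c a = s \<and> T = convex hull {a, b, c})"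

definition homothety :: "real ^ 2 \<Rightarrow> real \<Rightarrow> real ^ 2 \<Rightarrow> real ^ 2" where
  "homothety p k x = p + k *\<^sub>R (x - p)"

text \<open>
  The ratio may be negative. A homothety of ratio 1 is the identity, so a nontrivial
  translate of a triangle \<open>T\<close> is not homothetic to \<open>T\<close> in this sense; for any other ratio \<open>k\<close>,
  every map \<open>\<lambda>x. k *\<^sub>R x + v\<close> is a homothety. The two readings of ``homothetic'' (with or
  without translations) therefore agree on triangles of different side lengths.
\<close>

definition homothetic :: "(real ^ 2) set \<Rightarrow> (real ^ 2) set \<Rightarrow> bool" where
  "homothetic U T \<longleftrightarrow> (\<exists>p k. k \<noteq> 0 \<and> U = homothety p k ` T)"

end

theory Submission
  imports Defs
begin

text \<open>
  In affine coordinates, let the big triangle be \<open>x, y \<ge> 0, x + y \<le> s\<close>, and cut it by the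
  horizontal lines at heights \<open>h, h + 1, \<dots>, h + n - 1\<close>. A unit triangle meets these lines in
  total length at most \<open>1 - frac (\<sigma> (h - v))\<close>, where \<open>\<sigma> = \<plusminus>1\<close> is its orientation and \<open>v\<close> the height
  of its horizontal side. The excess \<open>G h\<close> of the sum of these lengths over the total length of the
  slices of the big triangle is nonnegative, and modulo 1 it is a linear function \<open>c + m h\<close> of \<open>h\<close>.
  The slope \<open>m\<close> is \<open>n\<close> minus a sum of \<open>n\<^sup>2 + 1\<close> signs, hence odd, hence nonzero. So
  \<open>G h \<ge> frac (c + m h)\<close> has mean at least \<open>1/2\<close> over a period, whereas the mean of \<open>G\<close> is
  \<open>1/2 - n (s - n)\<close>. Means are taken over \<open>2 ^ K\<close> equidistant points, which multiplication by the
  odd number \<open>m\<close> permutes.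
\<close>

section \<open>Fractional parts along arithmetic progressions\<close>

text \<open>Since \<open>m\<close> is invertible modulo \<open>N\<close>, the residues of
  \<open>p + m * j\<close> run through \<open>0, ..., N - 1\<close>, and the term for
  \<open>j\<close> is at least its residue divided by \<open>N\<close>. Applied both with the slope
  of \<open>G\<close> and with the signs of the triangles.\<close>

lemma sum_frac_arith_progression_ge:
  fixes c :: real and m :: int and N :: nat
  assumes "N > 0" "coprime m (int N)"
  shows "(\<Sum>j<N. frac (c + of_int m * real j / real N)) \<ge> (real N - 1) / 2"
proof -
  define p where "p = \<lfloor>real N * c\<rfloor>"
  define r where "r j = (p + m * int j) mod int N" for j :: nat
  have N: "real N > 0" using assms by simp
  have term_ge: "frac (c + of_int m * real j / real N) \<ge> of_int (r j) / real N" for j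
  proof -
    define q where "q = (p + m * int j) div int N"
    have "p + m * int j = int N * q + r j"
      unfolding q_def r_def by simp
    then have "real_of_int (p + m * int j) = real_of_int (int N * q + r j)"
      by simp
    then have e: "of_int p + of_int m * real j = real N * of_int q + of_int (r j)"
      by simp
    define t where "t = real N * c - of_int p"
    have t: "0 \<le> t" "t < 1" unfolding t_def p_def by linarith+
    have "c = (of_int p + t) / real N" using N by (simp add: t_def)
    then have "c + of_int m * real j / real N = (of_int p + of_int m * real j + t) / real N"
      by (simp add: add_divide_distrib)
    also have "\<dots> = of_int q + (of_int (r j) + t) / real N"
      unfolding e using N by (simp add: field_simps)
    finally have "frac (c + of_int m * real j / real N) = frac ((of_int (r j) + t) / real N)"
      by simp
    \<comment> \<open>The integer \<open>r j\<close> stays one below \<open>N\<close>, so adding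
      \<open>t < 1\<close> does not wrap around.\<close>
    moreover have "0 \<le> r j" "r j + 1 \<le> int N"
      using assms unfolding r_def by (auto simp: zless_imp_add1_zle)
    then have "0 \<le> real_of_int (r j)" "real_of_int (r j) + 1 \<le> real N"
      by linarith+
    then have "frac ((of_int (r j) + t) / real N) = (of_int (r j) + t) / real N"
      using t N by (subst frac_eq) (auto simp: divide_simps)
    ultimately show ?thesis using t N by (simp add: divide_right_mono)
  qed
  have inj: "inj_on r {..<N}"
  proof (rule inj_onI)
    fix i j assume ij: "i \<in> {..<N}" "j \<in> {..<N}" "r i = r j"
    then have "int N dvd (p + m * int i) - (p + m * int j)"
      unfolding r_def by (simp add: mod_eq_dvd_iff)
    then have "int N dvd m * (int i - int j)" by (simp add: algebra_simps)
    then have "int N dvd int i - int j"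
      using assms(2) by (simp add: coprime_dvd_mult_right_iff coprime_commute)
    then have "int i mod int N = int j mod int N" by (simp add: mod_eq_dvd_iff)
    then show "i = j" using ij by simp
  qed
  have "r ` {..<N} = int ` {..<N}"
  proof (rule card_subset_eq)
    have "r j \<in> int ` {..<N}" for j
      using assms by (intro image_eqI[of _ _ "nat (r j)"]) (auto simp: r_def nat_less_iff)
    then show "r ` {..<N} \<subseteq> int ` {..<N}" by auto
    show "card (r ` {..<N}) = card (int ` {..<N})"
      using inj by (simp add: card_image)
  qed simp
  then have "(\<Sum>j<N. real_of_int (r j)) = sum real_of_int (int ` {..<N})"
    using sum.reindex[OF inj, of real_of_int] by simp
  also have "\<dots> = (\<Sum>j<N. real j)"
    by (subst sum.reindex) auto
  also have "\<dots> = real N * (real N - 1) / 2"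
    by (induction N) (auto simp: field_simps)
  finally have "(\<Sum>j<N. of_int (r j) / real N) = (real N - 1) / 2"
    using N by (simp add: sum_divide_distrib[symmetric])
  moreover have "(\<Sum>j<N. of_int (r j) / real N) \<le> (\<Sum>j<N. frac (c + of_int m * real j / real N))"
    by (intro sum_mono term_ge)
  ultimately show ?thesis by simp
qed

section \<open>Horizontal slices of a cover\<close>

lemma length_le_sum_cover:
  fixes lo len :: "'a \<Rightarrow> real"
  assumes "finite I" "\<And>i. i \<in> I \<Longrightarrow> 0 \<le> len i" "{0..l} \<subseteq> (\<Union>i\<in>I. {lo i..lo i + len i})"
  shows "l \<le> (\<Sum>i\<in>I. len i)"
proof (cases "l \<ge> 0")
  case True
  have "l = measure lborel {0..l}" using True by simp
  also have "\<dots> \<le> measure lborel (\<Union>i\<in>I. {lo i..lo i + len i})"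
    using assms fmeasurable_cbox[of "lo i" "lo i + len i" for i]
    by (intro measure_mono_fmeasurable fmeasurable.finite_UN) auto
  also have "\<dots> \<le> (\<Sum>i\<in>I. measure lborel {lo i..lo i + len i})"
    using assms by (intro measure_UNION_le) auto
  also have "\<dots> = (\<Sum>i\<in>I. len i)" using assms by (intro sum.cong) auto
  finally show ?thesis .
next
  \<comment> \<open>Lines above the apex of the big triangle lead to a negative
    \<open>l\<close>.\<close>
  case False
  then show ?thesis using sum_nonneg[of I len, OF assms(2)] by linarith
qed

text \<open>Here \<open>t\<close> is the affine height of the line, measured from the horizontal
  side of a unit triangle towards the opposite vertex.\<close>

definition slice_length :: "real \<Rightarrow> real" where
  "slice_length t = (if 0 \<le> t \<and> t < 1 then 1 - t else 0)"

lemma slice_length_eq: "slice_length t \<noteq> 0 \<Longrightarrow> slice_length t = 1 - frac t"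
  by (auto simp: slice_length_def split: if_splits)

text \<open>In these coordinates a unit triangle has height 1, so at most one of the lines, which
  are 1 apart, has a nonzero slice. The integer shift \<open>\<sigma> * k\<close> does not affect
  \<open>frac\<close>. If every slice is zero, \<open>frac < 1\<close> suffices.\<close>

lemma sum_slice_length_le:
  fixes \<sigma> :: int
  assumes "\<sigma> \<in> {1, -1}"
  shows "(\<Sum>k<n. slice_length (of_int \<sigma> * (h + real k - v))) \<le> 1 - frac (of_int \<sigma> * (h - v))"
proof (cases "\<exists>k<n. slice_length (of_int \<sigma> * (h + real k - v)) \<noteq> 0")
  case True
  then obtain k where k: "k < n" "slice_length (of_int \<sigma> * (h + real k - v)) \<noteq> 0" by auto
  have "slice_length (of_int \<sigma> * (h + real j - v)) = 0" if "j \<noteq> k" for j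
  proof (rule ccontr)
    assume "slice_length (of_int \<sigma> * (h + real j - v)) \<noteq> 0"
    with k(2) have "\<bar>real j - real k\<bar> < 1"
      using assms by (auto simp: slice_length_def split: if_splits)
    with that show False by linarith
  qed
  then have "(\<Sum>j<n. slice_length (of_int \<sigma> * (h + real j - v)))
      = slice_length (of_int \<sigma> * (h + real k - v))"
    using k(1) by (subst sum.mono_neutral_right[of _ "{k}"]) auto
  also have "\<dots> = 1 - frac (of_int \<sigma> * (h - v) + of_int (\<sigma> * int k))"
    using slice_length_eq[OF k(2)] by (simp add: algebra_simps)
  finally show ?thesis by (simp only: frac_add_of_int_right)
next
  case False
  then have "(\<Sum>k<n. slice_length (of_int \<sigma> * (h + real k - v))) = 0" by simp
  then show ?thesis using frac_lt_1[of "of_int \<sigma> * (h - v)"] by linarith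
qed

text \<open>The point \<open>(u, v)\<close> is the vertex where the sides parallel to the axes meet;
  \<open>\<sigma> = -1\<close> gives the point reflection.\<close>

definition oriented_unit_triangle :: "int \<Rightarrow> real \<Rightarrow> real \<Rightarrow> (real \<times> real) set" where
  "oriented_unit_triangle \<sigma> u v = {(x, y). 0 \<le> of_int \<sigma> * (x - u) \<and> 0 \<le> of_int \<sigma> * (y - v)
      \<and> of_int \<sigma> * (x - u) + of_int \<sigma> * (y - v) \<le> 1}"

lemma slice_le_sum_slice_length:
  fixes I :: "'a set" and \<sigma> :: "'a \<Rightarrow> int"
  assumes "finite I" "\<And>i. i \<in> I \<Longrightarrow> \<sigma> i \<in> {1, -1}" "y \<ge> 0"
    and cover: "{(x, y). 0 \<le> x \<and> 0 \<le> y \<and> x + y \<le> s}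
        \<subseteq> (\<Union>i\<in>I. oriented_unit_triangle (\<sigma> i) (u i) (v i))"
  shows "s - y \<le> (\<Sum>i\<in>I. slice_length (of_int (\<sigma> i) * (y - v i)))"
proof -
  define t where "t i = of_int (\<sigma> i) * (y - v i)" for i
  \<comment> \<open>Closed at 1, because a line touching only the vertex still covers a point; such
    a slice has length 0.\<close>
  define J where "J = {i\<in>I. 0 \<le> t i \<and> t i \<le> 1}"
  \<comment> \<open>The slice starts at \<open>u i\<close> for positive orientation and ends there
    for negative orientation.\<close>
  define lo where "lo i = (if \<sigma> i = 1 then u i else u i - (1 - t i))" for i
  have "s - y \<le> (\<Sum>i\<in>J. 1 - t i)"
  proof (rule length_le_sum_cover[where lo = lo])
    show "finite J" using assms(1) by (simp add: J_def)
    show "{0..s - y} \<subseteq> (\<Union>i\<in>J. {lo i..lo i + (1 - t i)})"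
    proof
      fix x assume "x \<in> {0..s - y}"
      then have "(x, y) \<in> (\<Union>i\<in>I. oriented_unit_triangle (\<sigma> i) (u i) (v i))"
        using assms(3) by (intro subsetD[OF cover]) auto
      then obtain i where i: "i \<in> I" "0 \<le> of_int (\<sigma> i) * (x - u i)" "0 \<le> t i"
          "of_int (\<sigma> i) * (x - u i) + t i \<le> 1"
        unfolding oriented_unit_triangle_def t_def by auto
      then have "i \<in> J" by (auto simp: J_def)
      moreover have "x \<in> {lo i..lo i + (1 - t i)}"
        using i assms(2)[OF i(1)] by (auto simp: lo_def)
      ultimately show "x \<in> (\<Union>i\<in>J. {lo i..lo i + (1 - t i)})" by blast
    qed
  qed (simp add: J_def)
  also have "\<dots> = (\<Sum>i\<in>J. slice_length (t i))"
    by (intro sum.cong) (auto simp: J_def slice_length_def)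
  also have "\<dots> = (\<Sum>i\<in>I. slice_length (t i))"
    using assms(1) by (intro sum.mono_neutral_left) (auto simp: J_def slice_length_def)
  finally show ?thesis by (simp add: t_def)
qed

section \<open>Averaging over the heights\<close>

lemma sum_signs_parity:
  fixes \<sigma> :: "'a \<Rightarrow> int"
  assumes "finite I" "\<And>i. i \<in> I \<Longrightarrow> \<sigma> i \<in> {1, -1}"
  shows "even ((\<Sum>i\<in>I. \<sigma> i) - int (card I))"
  using assms
proof (induction I rule: finite_induct)
  case (insert i I)
  have "\<sigma> i = 1 \<or> \<sigma> i = -1" using insert.prems[of i] by simp
  then have "odd (\<sigma> i)" by auto
  moreover have "even ((\<Sum>i\<in>I. \<sigma> i) - int (card I))" using insert by simp
  ultimately show ?case using insert.hyps by simp
qed simp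

text \<open>With sums over \<open>N\<close> heights in place of integrals, the two estimates for the
  mean of \<open>G\<close> conflict only up to an error of order \<open>1 / N\<close>, so the
  contradiction appears for large \<open>N\<close>.\<close>

lemma no_cover_by_oriented_unit_triangles:
  fixes \<sigma> :: "nat \<Rightarrow> int"
  assumes "n > 0" "s > real n" "\<And>i. i < n\<^sup>2 + 1 \<Longrightarrow> \<sigma> i \<in> {1, -1}"
  shows "\<not> {(x, y). 0 \<le> x \<and> 0 \<le> y \<and> x + y \<le> s}
      \<subseteq> (\<Union>i<n\<^sup>2 + 1. oriented_unit_triangle (\<sigma> i) (u i) (v i))"
proof
  assume cover: "{(x, y). 0 \<le> x \<and> 0 \<le> y \<and> x + y \<le> s}
      \<subseteq> (\<Union>i<n\<^sup>2 + 1. oriented_unit_triangle (\<sigma> i) (u i) (v i))"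
  define M where "M = n\<^sup>2 + 1"
  define m where "m = int n - (\<Sum>i<M. \<sigma> i)"
  define F where "F h = (\<Sum>i<M. 1 - frac (of_int (\<sigma> i) * (h - v i)))" for h
  define G where "G h = F h - (\<Sum>k<n. s - (h + real k))" for h
  \<comment> \<open>Collects the terms of \<open>G h\<close> free of \<open>h\<close> after each
    \<open>frac\<close> is written as argument minus floor.\<close>
  define c where "c = real M + (\<Sum>i<M. of_int (\<sigma> i) * v i) - real n * s + (\<Sum>k<n. real k)"
  have G_nonneg: "0 \<le> G h" if "h \<ge> 0" for h
  proof -
    have "(\<Sum>k<n. s - (h + real k)) \<le> (\<Sum>k<n. \<Sum>i<M. slice_length (of_int (\<sigma> i) * (h + real k - v i)))"
      using assms(3) cover that unfolding M_def
      by (intro sum_mono slice_le_sum_slice_length) auto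
    also have "\<dots> = (\<Sum>i<M. \<Sum>k<n. slice_length (of_int (\<sigma> i) * (h + real k - v i)))"
      by (rule sum.swap)
    also have "\<dots> \<le> F h"
      unfolding F_def using assms(3) by (intro sum_mono sum_slice_length_le) (simp add: M_def)
    finally show ?thesis by (simp add: G_def)
  qed
  have G_mod_1: "G h = c + of_int m * h + of_int (\<Sum>i<M. \<lfloor>of_int (\<sigma> i) * (h - v i)\<rfloor>)" for h
    by (simp add: G_def F_def c_def m_def frac_def sum.distrib sum_subtractf
        algebra_simps sum_distrib_left)
  \<comment> \<open>A nonnegative real is at least its fractional part.\<close>
  have G_ge: "frac (c + of_int m * h) \<le> G h" if "h \<ge> 0" for h
  proof -
    have "frac (c + of_int m * h) = frac (G h)"
      unfolding G_mod_1 by (simp only: frac_add_of_int_right)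
    also have "\<dots> \<le> G h" using G_nonneg[OF that] by (simp add: frac_def)
    finally show ?thesis .
  qed
  have "even ((\<Sum>i<M. \<sigma> i) - int M)"
    using sum_signs_parity[of "{..<M}" \<sigma>] assms(3) by (simp add: M_def)
  \<comment> \<open>Modulo 2, \<open>m\<close> is \<open>n - (n\<^sup>2 + 1)\<close>, and
    \<open>n\<close> and \<open>n\<^sup>2\<close> have equal parity.\<close>
  then have "odd m" by (simp add: m_def M_def)
  \<comment> \<open>A power of two is coprime to every odd \<open>m\<close>, whatever its size. The
    terms of order \<open>N\<close> combine to the left side; the right side is the discretisation
    error.\<close>
  have bound: "2 * real n * (s - real n) * real N \<le> (real n)\<^sup>2 + 2 - real n"
    if N: "N = 2 ^ K" for N K :: nat
  proof -
    have "N > 0" using N by simp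
    have "coprime m (int N)"
      using \<open>odd m\<close> N by (simp add: coprime_commute)
    then have "(real N - 1) / 2 \<le> (\<Sum>j<N. frac (c + of_int m * real j / real N))"
      by (rule sum_frac_arith_progression_ge[OF \<open>N > 0\<close>])
    also have "\<dots> \<le> (\<Sum>j<N. G (real j / real N))"
      using G_ge[of "real j / real N" for j] by (intro sum_mono) simp
    also have "\<dots> = (\<Sum>j<N. F (real j / real N)) - (\<Sum>j<N. \<Sum>k<n. s - (real j / real N + real k))"
      by (simp add: G_def sum_subtractf)
    finally have 1: "(real N - 1) / 2 + (\<Sum>j<N. \<Sum>k<n. s - (real j / real N + real k))
        \<le> (\<Sum>j<N. F (real j / real N))" by argo
    have gauss: "(\<Sum>j<k. real j) = real k * (real k - 1) / 2" for k
      by (induction k) (auto simp: field_simps)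
    have "(\<Sum>j<N. \<Sum>k<n. s - (real j / real N + real k))
        = real N * real n * s - real n * ((\<Sum>j<N. real j) / real N) - real N * (\<Sum>k<n. real k)"
      by (simp add: sum.distrib sum_subtractf sum_distrib_left sum_divide_distrib algebra_simps)
    also have "\<dots> = real N * real n * s - real n * (real N - 1) / 2 - real N * (real n * (real n - 1) / 2)"
      using \<open>N > 0\<close> by (simp add: gauss)
    finally have 2: "(\<Sum>j<N. \<Sum>k<n. s - (real j / real N + real k)) = \<dots>" .
    have "(\<Sum>j<N. F (real j / real N))
        = (\<Sum>i<M. \<Sum>j<N. 1 - frac (of_int (\<sigma> i) * (real j / real N - v i)))"
      unfolding F_def by (rule sum.swap)
    also have "\<dots> \<le> (\<Sum>i<M. real N - (real N - 1) / 2)"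
    proof (rule sum_mono)
      fix i assume "i \<in> {..<M}"
      \<comment> \<open>Each sign is a unit, so the progression lemma also bounds the contribution
        of each small triangle from above.\<close>
      then have "coprime (\<sigma> i) (int N)" using assms(3)[of i] by (auto simp: M_def)
      from sum_frac_arith_progression_ge[OF \<open>N > 0\<close> this, of "- of_int (\<sigma> i) * v i"]
      show "(\<Sum>j<N. 1 - frac (of_int (\<sigma> i) * (real j / real N - v i))) \<le> real N - (real N - 1) / 2"
        by (simp add: sum_subtractf algebra_simps)
    qed
    also have "\<dots> = ((real n)\<^sup>2 + 1) * (real N + 1) / 2"
      by (simp add: M_def field_simps)
    finally show ?thesis using 1 unfolding 2
      by (simp add: field_simps power2_eq_square)
  qed
  have pos: "2 * real n * (s - real n) > 0" using assms by simp
  obtain K where "((real n)\<^sup>2 + 2 - real n) / (2 * real n * (s - real n)) < 2 ^ K"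
    using real_arch_pow[of 2] by auto
  then have "(real n)\<^sup>2 + 2 - real n < 2 * real n * (s - real n) * real (2 ^ K)"
    using pos by (simp add: pos_divide_less_eq mult.commute)
  with bound[OF refl, of K] show False by linarith
qed

section \<open>Affine coordinates for equilateral triangles\<close>

text \<open>Distances in a simplex are maximal at vertices. This bounds the ratio of a homothety
  without matching the vertices of the two triangles.\<close>

lemma equilateral_triangle_dist_le:
  assumes "equilateral_triangle l U" "x \<in> U" "y \<in> U"
  shows "dist x y \<le> l"
proof -
  obtain a b c where abc: "l > 0" "dist a b = l" "dist b c = l" "dist c a = l" "U = convex hull {a, b, c}"
    using assms(1) unfolding equilateral_triangle_def by auto
  then obtain p q where "p \<in> {a, b, c}" "q \<in> {a, b, c}" "norm (x - y) \<le> norm (p - q)"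
    using simplex_extremal_le_exists[of "{a, b, c}" x y] assms by blast
  then show ?thesis using abc by (auto simp: dist_norm norm_minus_commute)
qed

text \<open>The inner product of \<open>B\<close> and \<open>C\<close> is
  \<open>s\<^sup>2 / 2\<close>, so the squared norm of the combination is \<open>s\<^sup>2\<close>
  times the positive definite form \<open>x\<^sup>2 + y\<^sup>2 + x * y\<close>.\<close>

lemma equilateral_coordinates_inj:
  fixes B C :: "'a::real_inner"
  assumes "norm B = s" "norm C = s" "norm (C - B) = s" "s > 0" "x *\<^sub>R B + y *\<^sub>R C = 0"
  shows "x = 0 \<and> y = 0"
proof -
  have BB: "B \<bullet> B = s\<^sup>2" "C \<bullet> C = s\<^sup>2" "(C - B) \<bullet> (C - B) = s\<^sup>2"
    using assms by (simp_all add: dot_square_norm)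
  then have BC: "B \<bullet> C = s\<^sup>2 / 2" by (simp add: inner_diff inner_commute)
  have "0 = (x *\<^sub>R B + y *\<^sub>R C) \<bullet> (x *\<^sub>R B + y *\<^sub>R C)" using assms by simp
  also have "\<dots> = s\<^sup>2 * (x\<^sup>2 + y\<^sup>2 + x * y)"
    using BB BC by (simp add: inner_add inner_commute algebra_simps power2_eq_square)
  finally have "x\<^sup>2 + y\<^sup>2 + x * y = 0" using assms(4) by simp
  moreover have "2 * (x\<^sup>2 + y\<^sup>2 + x * y) = x\<^sup>2 + y\<^sup>2 + (x + y)\<^sup>2"
    by (simp add: power2_eq_square algebra_simps)
  ultimately have "x\<^sup>2 + y\<^sup>2 + (x + y)\<^sup>2 = 0" by simp
  then show ?thesis
    by (smt (verit) zero_le_power2 power2_eq_iff zero_eq_power2)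
qed

text \<open>In coordinates the homothety multiplies by \<open>k\<close> and translates, so the sign
  of \<open>k\<close> is the orientation. Dividing by \<open>s\<close> gives unit triangles legs of
  length 1. An inclusion is enough for transferring a cover, and it needs only
  \<open>\<bar>k\<bar> * s \<le> 1\<close>.\<close>

lemma homothetic_unit_triangle_coordinates:
  fixes a b c :: "real ^ 2"
  defines "P \<equiv> \<lambda>(x, y). a + x *\<^sub>R (b - a) + y *\<^sub>R (c - a)"
  assumes "s > 0" "dist a b = s" "dist b c = s" "dist c a = s"
    and "equilateral_triangle 1 U" "homothetic U (convex hull {a, b, c})"
  shows "\<exists>\<sigma> u v. \<sigma> \<in> {1, -1}
      \<and> (\<forall>x y. P (x / s, y / s) \<in> U \<longrightarrow> (x, y) \<in> oriented_unit_triangle \<sigma> u v)"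
proof -
  obtain p k where k: "k \<noteq> 0" and U: "U = homothety p k ` (convex hull {a, b, c})"
    using assms(7) unfolding homothetic_def by auto
  have "dist (homothety p k a) (homothety p k b) \<le> 1"
    using assms(6) by (rule equilateral_triangle_dist_le) (auto simp: U hull_inc)
  moreover have "homothety p k a - homothety p k b = k *\<^sub>R (a - b)"
    by (simp add: homothety_def algebra_simps)
  ultimately have ks: "\<bar>k\<bar> * s \<le> 1" using assms(3) by (simp add: dist_norm)
  have P_inj: "x = 0 \<and> y = 0" if "x *\<^sub>R (b - a) + y *\<^sub>R (c - a) = 0" for x y
    using assms that
    by (intro equilateral_coordinates_inj[of "b - a" s "c - a"])
      (auto simp: dist_norm norm_minus_commute)
  have in_U: "\<exists>x' y'. 0 \<le> x' \<and> 0 \<le> y' \<and> x' + y' \<le> s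
      \<and> P (x / s, y / s) = homothety p k (P (x' / s, y' / s))" if xy: "P (x / s, y / s) \<in> U" for x y
  proof -
    obtain z where z: "z \<in> convex hull {a, b, c}" "P (x / s, y / s) = homothety p k z"
      using xy unfolding U by blast
    obtain \<alpha> \<beta> where "0 \<le> \<alpha>" "0 \<le> \<beta>" "\<alpha> + \<beta> \<le> 1"
        and z_eq: "z = a + \<alpha> *\<^sub>R (b - a) + \<beta> *\<^sub>R (c - a)"
      using z(1) unfolding convex_hull_3_alt by blast
    have "P (x / s, y / s) = homothety p k (P (\<alpha>, \<beta>))"
      unfolding z(2) z_eq by (simp only: P_def split_conv)
    moreover have "s * \<alpha> + s * \<beta> \<le> s"
      using \<open>\<alpha> + \<beta> \<le> 1\<close> \<open>s > 0\<close> by (metis distrib_left mult.right_neutral mult_le_cancel_left_pos)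
    ultimately show ?thesis
      using \<open>s > 0\<close> \<open>0 \<le> \<alpha>\<close> \<open>0 \<le> \<beta>\<close> by (intro exI[of _ "s * \<alpha>"] exI[of _ "s * \<beta>"]) auto
  qed
  show ?thesis
  \<comment> \<open>A base point in \<open>U\<close> fixes the translation; without one the claim is
    vacuous, so surjectivity of \<open>P\<close> need not be shown.\<close>
  proof (cases "\<exists>x y. P (x / s, y / s) \<in> U")
    case False
    then show ?thesis by (intro exI[of _ 1]) auto
  next
    case True
    then obtain x0 y0 x1 y1 where e0: "P (x0 / s, y0 / s) = homothety p k (P (x1 / s, y1 / s))"
      using in_U by blast
    define \<sigma> :: int where "\<sigma> = (if k > 0 then 1 else -1)"
    have \<sigma>k: "of_int \<sigma> * k = \<bar>k\<bar>" using k by (simp add: \<sigma>_def)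
    \<comment> \<open>\<open>(u, v)\<close> are the scaled coordinates of the image of the vertex
      \<open>a\<close>.\<close>
    define u where "u = x0 - k * x1"
    define v where "v = y0 - k * y1"
    have "(x, y) \<in> oriented_unit_triangle \<sigma> u v" if xy: "P (x / s, y / s) \<in> U" for x y
    proof -
      obtain x' y' where x': "0 \<le> x'" "0 \<le> y'" "x' + y' \<le> s"
          and e: "P (x / s, y / s) = homothety p k (P (x' / s, y' / s))"
        using in_U[OF xy] by blast
      \<comment> \<open>Subtracting the base point eliminates the centre \<open>p\<close>.\<close>
      have "P (x / s, y / s) - P (x0 / s, y0 / s)
          - k *\<^sub>R (P (x' / s, y' / s) - P (x1 / s, y1 / s)) = 0"
        unfolding e e0 by (simp add: homothety_def algebra_simps)
      moreover have "P (x / s, y / s) - P (x0 / s, y0 / s)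
          - k *\<^sub>R (P (x' / s, y' / s) - P (x1 / s, y1 / s))
          = ((x - u - k * x') / s) *\<^sub>R (b - a) + ((y - v - k * y') / s) *\<^sub>R (c - a)"
        by (simp add: P_def u_def v_def algebra_simps diff_divide_distrib add_divide_distrib)
      ultimately have "(x - u - k * x') / s = 0" "(y - v - k * y') / s = 0"
        using P_inj by metis+
      then have xu: "of_int \<sigma> * (x - u) = \<bar>k\<bar> * x'" "of_int \<sigma> * (y - v) = \<bar>k\<bar> * y'"
        using \<open>s > 0\<close> by (simp_all flip: \<sigma>k)
      have "\<bar>k\<bar> * x' + \<bar>k\<bar> * y' \<le> \<bar>k\<bar> * s"
        using x' by (simp flip: distrib_left add: mult_left_mono)
      then show ?thesis
        using ks x' unfolding oriented_unit_triangle_def by (simp add: xu)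
    qed
    moreover have "\<sigma> \<in> {1, -1}" by (simp add: \<sigma>_def)
    ultimately show ?thesis by blast
  qed
qed

theorem theorem2:
  fixes n :: nat and s :: real and T :: "(real ^ 2) set"
  assumes "n > 0"
    and "equilateral_triangle s T"
    and "s > real n"
  shows "\<not> (\<exists>U :: nat \<Rightarrow> (real ^ 2) set.
            (\<forall>i < n\<^sup>2 + 1. equilateral_triangle 1 (U i) \<and> homothetic (U i) T) \<and>
            T \<subseteq> (\<Union>i < n\<^sup>2 + 1. U i))"
proof
  assume "\<exists>U :: nat \<Rightarrow> (real ^ 2) set.
            (\<forall>i < n\<^sup>2 + 1. equilateral_triangle 1 (U i) \<and> homothetic (U i) T) \<and>
            T \<subseteq> (\<Union>i < n\<^sup>2 + 1. U i)"
  then obtain U :: "nat \<Rightarrow> (real ^ 2) set"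
    where U: "\<And>i. i < n\<^sup>2 + 1 \<Longrightarrow> equilateral_triangle 1 (U i)"
      "\<And>i. i < n\<^sup>2 + 1 \<Longrightarrow> homothetic (U i) T"
      and cover: "T \<subseteq> (\<Union>i < n\<^sup>2 + 1. U i)" by auto
  obtain a b c where abc: "s > 0" "dist a b = s" "dist b c = s" "dist c a = s"
    and T: "T = convex hull {a, b, c}"
    using assms(2) unfolding equilateral_triangle_def by auto
  define P where "P = (\<lambda>(x, y). a + x *\<^sub>R (b - a) + y *\<^sub>R (c - a))"
  \<comment> \<open>The bound on \<open>i\<close> stands inside the existential so that
    \<open>\<sigma>\<close>, \<open>u\<close>, \<open>v\<close> can be chosen as total
    functions.\<close>
  have "\<forall>i. \<exists>\<sigma> u v. i < n\<^sup>2 + 1 \<longrightarrow> \<sigma> \<in> {1, -1}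
      \<and> (\<forall>x y. P (x / s, y / s) \<in> U i \<longrightarrow> (x, y) \<in> oriented_unit_triangle \<sigma> u v)"
  proof
    fix i
    show "\<exists>\<sigma> u v. i < n\<^sup>2 + 1 \<longrightarrow> \<sigma> \<in> {1, -1}
      \<and> (\<forall>x y. P (x / s, y / s) \<in> U i \<longrightarrow> (x, y) \<in> oriented_unit_triangle \<sigma> u v)"
    proof (cases "i < n\<^sup>2 + 1")
      case True
      from homothetic_unit_triangle_coordinates[OF abc U(1)[OF True] U(2)[OF True, unfolded T],
          folded P_def]
      show ?thesis by blast
    qed simp
  qed
  then obtain \<sigma> u v where \<sigma>: "\<And>i. i < n\<^sup>2 + 1 \<Longrightarrow> \<sigma> i \<in> {1, -1}"
    and in_U: "\<And>i x y. i < n\<^sup>2 + 1 \<Longrightarrow> P (x / s, y / s) \<in> U i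
        \<Longrightarrow> (x, y) \<in> oriented_unit_triangle (\<sigma> i) (u i) (v i)"
    by metis
  have "{(x, y). 0 \<le> x \<and> 0 \<le> y \<and> x + y \<le> s}
      \<subseteq> (\<Union>i<n\<^sup>2 + 1. oriented_unit_triangle (\<sigma> i) (u i) (v i))"
  proof clarify
    fix x y :: real
    assume xy: "0 \<le> x" "0 \<le> y" "x + y \<le> s"
    then have "0 \<le> x / s" "0 \<le> y / s" "x / s + y / s \<le> 1"
      using abc(1) by (simp_all flip: add_divide_distrib)
    then have "P (x / s, y / s) \<in> T"
      unfolding T convex_hull_3_alt P_def split_conv by blast
    then obtain i where "i < n\<^sup>2 + 1" "P (x / s, y / s) \<in> U i" using cover by auto
    then show "(x, y) \<in> (\<Union>i<n\<^sup>2 + 1. oriented_unit_triangle (\<sigma> i) (u i) (v i))"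
      using in_U by blast
  qed
  then show False
    by (rule notE[OF no_cover_by_oriented_unit_triangles[OF assms(1,3)], rotated]) (rule \<sigma>)
qed

end
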